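(* Let $\lambda>0$, let $\mu,\nu\in P_2(\mathbb{R}^d)$, and let $\varphi:\mathbb{R}^d\to\mathbb{R}$ be such that $(\mu,\nu,\varphi)$ is $\lambda$-regular; let $T=\nabla\varphi$ be the optimal transport map from $\mu$ to $\nu$ and let $\gamma=(\mathrm{id},T)_\#\mu$ be the optimal transport plan induced by $T$. Let $\mu_h,\nu_h\in P_2(\mathbb{R}^d)$ and let $\gamma_h\in\Pi(\mu_h,\nu_h)$ be any transport plan between $\mu_h$ and $\nu_h$ (not necessarily optimal). Set $$e_h:=W_2(\mu,\mu_h)+W_2(\nu,\nu_h),\qquad \varepsilon_h:=\Big(\int_{\mathbb{R}^d\times\mathbb{R}^d}|x'-y'|^2\,d\gamma_h(x',y')\Big)^{1/2}-W_2(\mu_h,\nu_h),\qquad \widetilde e_h:=e_h+\frac{\varepsilon_h}{2}.$$ Then $$W_2(\gamma,\gamma_h)\le 2\lambda^{1/2}\,\widetilde e_h^{\,1/2}\big(W_2(\mu,\nu)+\widetilde e_h\big)^{1/2}+e_h,$$ where $W_2(\gamma,\gamma_h)$ is the quadratic Wasserstein distance on $P_2(\mathbb{R}^{2d})$.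
   Context: $P_2(\mathbb{R}^n)$ is the set of Borel probability measures on $\mathbb{R}^n$ with finite second moment. $\Pi(\mu,\nu)$ is the set of transport plans, i.e. Borel probability measures on the product space with first marginal $\mu$ and second marginal $\nu$. $W_2(\mu,\nu)=\big(\min_{\gamma\in\Pi(\mu,\nu)}\int|x-y|^2\,d\gamma(x,y)\big)^{1/2}$ is the quadratic Wasserstein distance (with Euclidean norm); a plan attaining the minimum is called optimal. A map $T$ is an optimal transport map from $\mu$ to $\nu$ if $T_\#\mu=\nu$ and $T$ minimizes $\int|x-S(x)|^2\,d\mu(x)$ among all measurable maps $S$ with $S_\#\mu=\nu$. $\lambda$-regularity: $(\mu,\nu,\varphi)$ is $\lambda$-regular ($\lambda>0$) if $\varphi:\mathbb{R}^d\to\mathbb{R}$ is convex, $\nabla\varphi$ is the optimal transport map from $\mu$ to $\nu$ (for the quadratic cost), and $\varphi$ is $\lambda$-smooth, meaning $$\varphi((1-t)x_0+tx_1)+\frac{t(1-t)\lambda}{2}|x_0-x_1|^2\ge(1-t)\varphi(x_0)+t\varphi(x_1)$$ for all $x_0,x_1\in\mathbb{R}^d$, $t\in[0,1]$; equivalently, $\frac{\lambda}{2}|x|^2-\varphi(x)$ is convex. (Such a $\varphi$ is differentiable everywhere, so $T=\nabla\varphi$ is defined on all of $\mathbb{R}^d$.) *)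

theory Defs
  imports "HOL-Probability.Probability"
begin

definition P2 :: "'a::euclidean_space measure set" where
  "P2 = {M. prob_space M \<and> sets M = sets borel \<and> integrable M (\<lambda>x. (norm x)\<^sup>2)}"

definition transport_plans ::
  "'a::euclidean_space measure \<Rightarrow> 'a measure \<Rightarrow> ('a \<times> 'a) measure set" where
  "transport_plans \<mu> \<nu> =
    {\<gamma>. prob_space \<gamma> \<and> sets \<gamma> = sets borel \<and> distr \<gamma> borel fst = \<mu> \<and> distr \<gamma> borel snd = \<nu>}"

definition transport_cost :: "('a::euclidean_space \<times> 'a) measure \<Rightarrow> ennreal" where
  "transport_cost \<gamma> = (\<integral>\<^sup>+ z. ennreal ((norm (fst z - snd z))\<^sup>2) \<partial>\<gamma>)"

text \<open>
  The infimum is taken in \<^typ>\<open>ennreal\<close>, so a plan of infinite cost counts as infinite. It is finite,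
  and attained, for measures in \<^const>\<open>P2\<close>. At a product type \<^typ>\<open>'a \<times> 'a\<close> the norm
  is the Euclidean one, so the same definition is the distance on the measures over the product space.
\<close>

definition W2 :: "'a::euclidean_space measure \<Rightarrow> 'a measure \<Rightarrow> real" where
  "W2 \<mu> \<nu> = sqrt (enn2real (INF \<gamma>\<in>transport_plans \<mu> \<nu>. transport_cost \<gamma>))"

definition optimal_transport_map ::
  "'a::euclidean_space measure \<Rightarrow> 'a measure \<Rightarrow> ('a \<Rightarrow> 'a) \<Rightarrow> bool" where
  "optimal_transport_map \<mu> \<nu> T \<longleftrightarrow>
    T \<in> borel_measurable borel \<and> distr \<mu> borel T = \<nu> \<and>
    (\<forall>S \<in> borel_measurable borel. distr \<mu> borel S = \<nu> \<longrightarrow>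
      (\<integral>\<^sup>+ x. ennreal ((norm (x - T x))\<^sup>2) \<partial>\<mu>) \<le> (\<integral>\<^sup>+ x. ennreal ((norm (x - S x))\<^sup>2) \<partial>\<mu>))"

text \<open>
  The value is meaningful only at points of differentiability; a convex function that is
  smooth in the sense below is differentiable everywhere.
\<close>

definition gradient :: "('a::euclidean_space \<Rightarrow> real) \<Rightarrow> 'a \<Rightarrow> 'a" where
  "gradient f x = (THE g. GDERIV f x :> g)"

definition lambda_smooth :: "real \<Rightarrow> ('a::euclidean_space \<Rightarrow> real) \<Rightarrow> bool" where
  "lambda_smooth L \<phi> \<longleftrightarrow>
    (\<forall>x0 x1. \<forall>t\<in>{0..1}.
      \<phi> ((1 - t) *\<^sub>R x0 + t *\<^sub>R x1) + t * (1 - t) * L / 2 * (norm (x0 - x1))\<^sup>2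
        \<ge> (1 - t) * \<phi> x0 + t * \<phi> x1)"

definition lambda_regular ::
  "real \<Rightarrow> 'a::euclidean_space measure \<Rightarrow> 'a measure \<Rightarrow> ('a \<Rightarrow> real) \<Rightarrow> bool" where
  "lambda_regular L \<mu> \<nu> \<phi> \<longleftrightarrow>
    convex_on UNIV \<phi> \<and> optimal_transport_map \<mu> \<nu> (gradient \<phi>) \<and> lambda_smooth L \<phi>"

end

theory Submission imports Defs begin

text \<open>
  Take a random vector \<open>(X, Y, X', Y')\<close> with \<open>X\<close>, \<open>Y\<close> of laws \<open>\<mu>\<close>, \<open>\<nu>\<close>, with \<open>(X', Y')\<close> of law
  \<open>\<gamma>\<^sub>h\<close>, and with \<open>(X, X')\<close>, \<open>(Y, Y')\<close> nearly optimal. Since \<open>\<phi>\<close> is \<open>L\<close>-smooth, its conjugate is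
  \<open>1/L\<close>-strongly convex, so the Fenchel gap \<open>\<phi> x + \<phi>\<^sup>* y - x \<bullet> y\<close> is at least \<open>|T x - y|\<^sup>2 / (2 L)\<close>.
  Integrating at \<open>(X, Y)\<close> gives \<open>E |T X - Y|\<^sup>2 \<le> L (E |X - Y|\<^sup>2 - E |X - T X|\<^sup>2)\<close>. Minkowski's inequality
  bounds \<open>E |X - Y|\<^sup>2\<close> by \<open>(W2 \<mu> \<nu> + 2 e')\<^sup>2\<close>, whereas \<open>E |X - T X|\<^sup>2 \<ge> (W2 \<mu> \<nu>)\<^sup>2\<close>; finally \<open>(X, T X)\<close> is compared
  with \<open>(X', Y')\<close>. No disintegration theorem is used: couplings are glued along a common marginal only
  up to an error \<open>\<delta>\<close>, by conditioning on the cells of a fine countable partition, and \<open>\<delta>\<close> tends to \<open>0\<close>.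
\<close>

section \<open>Smooth convex functions\<close>

text \<open>A hyperplane separates \<open>(x, f x)\<close> from the strict epigraph of
  \<open>f\<close>; dividing its normal by the positive vertical component \<open>s\<close> yields
  the subgradient.\<close>

lemma convex_on_subgradient:
  fixes f :: "'a::euclidean_space \<Rightarrow> real"
  assumes "convex_on UNIV f"
  obtains g where "\<And>z. f x + inner g (z - x) \<le> f z"
proof -
  let ?E = "{p. f (fst p) < snd p}"
  have "convex ?E"
  proof (rule convexI)
    fix p q :: "'a \<times> real" and u v :: real
    assume pq: "p \<in> ?E" "q \<in> ?E" and uv: "0 \<le> u" "0 \<le> v" "u + v = 1"
    have "f (u *\<^sub>R fst p + v *\<^sub>R fst q) \<le> u * f (fst p) + v * f (fst q)"
      using assms uv unfolding convex_on_def by auto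
    also have "\<dots> < u * snd p + v * snd q"
    proof (cases "u = 0")
      case True
      then show ?thesis using pq uv by auto
    next
      case False
      then show ?thesis using pq uv
        by (intro add_less_le_mono mult_strict_left_mono mult_left_mono) auto
    qed
    finally show "u *\<^sub>R p + v *\<^sub>R q \<in> ?E" by simp
  qed
  moreover have "(x, f x + 1) \<in> ?E" by simp
  moreover have "{(x, f x)} \<inter> ?E = {}" by auto
  ultimately have "\<exists>a b. a \<noteq> 0 \<and> (\<forall>p\<in>{(x, f x)}. inner a p \<le> b) \<and> (\<forall>p\<in>?E. b \<le> inner a p)"
    by (intro separating_hyperplane_sets) (auto simp del: Int_insert_left intro!: gt_ex)
  then obtain a b where a: "a \<noteq> 0" "\<forall>p\<in>{(x, f x)}. inner a p \<le> b" "\<forall>p\<in>?E. b \<le> inner a p"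
    by blast
  obtain p s where ps: "a = (p, s)" by force
  have sep: "inner p x + s * f x \<le> inner p z + s * t" if "f z < t" for z t
    using a(2,3) that by (force simp: ps)
  have "s \<ge> 0"
    using sep[of x "f x + 1"] by (simp add: algebra_simps)
  \<comment> \<open>A vertical hyperplane cannot occur: tested at \<open>x - p\<close> it would
    force \<open>p = 0\<close>, and the normal is nonzero.\<close>
  moreover have "s \<noteq> 0"
  proof
    assume "s = 0"
    then have "inner p x \<le> inner p z" for z using sep[of z "f z + 1"] by simp
    from this[of "x - p"] have "inner p p \<le> 0" by (simp add: inner_diff_right)
    then show False using a(1) \<open>s = 0\<close> ps
      by (metis inner_eq_zero_iff inner_ge_zero order_antisym zero_prod_def)
  qed
  ultimately have s: "s > 0" by simp
  have "f x + inner (- (1 / s) *\<^sub>R p) (z - x) \<le> f z" for z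
  \<comment> \<open>The strict epigraph only gives the bound for every \<open>t > f z\<close>, hence
    the passage to the infimum over \<open>t\<close>.\<close>
  proof (rule dense_ge)
    fix t assume "f z < t"
    from sep[OF this] have "s * f x - inner p (z - x) \<le> s * t"
      by (simp add: inner_diff_right)
    with s show "f x + inner (- (1 / s) *\<^sub>R p) (z - x) \<le> t"
      by (simp add: field_simps)
  qed
  then show ?thesis by (rule that)
qed

lemma GDERIV_quadratic_bound:
  fixes f :: "'a::euclidean_space \<Rightarrow> real"
  assumes "\<And>z. \<bar>f z - f x - inner g (z - x)\<bar> \<le> C * (norm (z - x))\<^sup>2"
  shows "GDERIV f x :> g"
  unfolding gderiv_def has_derivative_at_within
proof (intro conjI)
  show "bounded_linear (\<lambda>h. inner h g)" by (rule bounded_linear_inner_left)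
  show "((\<lambda>y. (f y - f x - inner (y - x) g) /\<^sub>R norm (y - x)) \<longlongrightarrow> 0) (at x)"
  proof (rule Lim_null_comparison)
    show "\<forall>\<^sub>F y in at x. norm ((f y - f x - inner (y - x) g) /\<^sub>R norm (y - x)) \<le> C * norm (y - x)"
    proof (rule eventually_at_filter[THEN iffD2], rule always_eventually, intro allI impI)
      fix y assume "y \<noteq> x"
      then have "norm (y - x) > 0" by simp
      moreover have "\<bar>f y - f x - inner (y - x) g\<bar> \<le> (C * norm (y - x)) * norm (y - x)"
        using assms[of y] by (simp add: inner_commute power2_eq_square mult.assoc)
      ultimately show "norm ((f y - f x - inner (y - x) g) /\<^sub>R norm (y - x)) \<le> C * norm (y - x)"
        by (simp add: field_simps)
    qed
    show "((\<lambda>y. C * norm (y - x)) \<longlongrightarrow> 0) (at x)"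
      by (intro tendsto_eq_intros) auto
  qed
qed

lemma GDERIV_unique:
  assumes "GDERIV f x :> g" "GDERIV f x :> g'"
  shows "g = g'"
proof -
  have "(\<lambda>h. inner h g) = (\<lambda>h. inner h g')"
    using assms unfolding gderiv_def by (rule has_derivative_unique)
  then have "inner (g - g') g = inner (g - g') g'" by metis
  then have "inner (g - g') (g - g') = 0" by (simp add: inner_diff_right)
  then show ?thesis by simp
qed

text \<open>Smoothness at the midpoint \<open>x\<close> of \<open>z\<close> and its reflection
  \<open>2 *\<^sub>R x - z\<close> turns a subgradient inequality into a quadratic upper bound. The
  subgradient is therefore the derivative. This first bound has constant \<open>L\<close>; a second
  use of smoothness improves it to \<open>L / 2\<close>.\<close>

lemma smooth_convex_gradient_bounds:
  fixes f :: "'a::euclidean_space \<Rightarrow> real"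
  assumes "convex_on UNIV f" "lambda_smooth L f"
  shows "f x + inner (gradient f x) (z - x) \<le> f z"
    and "f z \<le> f x + inner (gradient f x) (z - x) + L / 2 * (norm (z - x))\<^sup>2"
proof -
  obtain g where g: "\<And>z. f x + inner g (z - x) \<le> f z"
    using convex_on_subgradient[OF assms(1)] by blast
  have smooth: "(1 - t) * f x0 + t * f x1
      \<le> f ((1 - t) *\<^sub>R x0 + t *\<^sub>R x1) + t * (1 - t) * L / 2 * (norm (x0 - x1))\<^sup>2"
    if "0 \<le> t" "t \<le> 1" for x0 x1 t
    using assms(2) that unfolding lambda_smooth_def by auto
  have upper: "f z \<le> f x + inner g (z - x) + L * (norm (z - x))\<^sup>2" for z
  proof -
    have mid: "(1/2) *\<^sub>R (2 *\<^sub>R x - z) + (1/2) *\<^sub>R z = x" by (simp add: algebra_simps)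
    have "(2 *\<^sub>R x - z) - z = 2 *\<^sub>R (x - z)" by (simp add: algebra_simps scaleR_2)
    then have nrm: "(norm ((2 *\<^sub>R x - z) - z))\<^sup>2 = 4 * (norm (z - x))\<^sup>2"
      by (simp add: norm_minus_commute power_mult_distrib)
    have "f (2 *\<^sub>R x - z) / 2 + f z / 2 \<le> f x + L / 2 * (norm (z - x))\<^sup>2"
      using smooth[of "1/2" "2 *\<^sub>R x - z" z] mid nrm by simp
    moreover have "inner g (2 *\<^sub>R x - z - x) = - inner g (z - x)"
      by (simp add: scaleR_2 inner_diff_right inner_add_right)
    then have "f x - inner g (z - x) \<le> f (2 *\<^sub>R x - z)"
      using g[of "2 *\<^sub>R x - z"] by simp
    ultimately show ?thesis by simp
  qed
  have "\<bar>f z - f x - inner g (z - x)\<bar> \<le> L * (norm (z - x))\<^sup>2" for z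
    using g[of z] upper[of z] by simp
  then have "GDERIV f x :> g" by (rule GDERIV_quadratic_bound)
  then have [simp]: "gradient f x = g"
    unfolding gradient_def by (auto intro: the_equality GDERIV_unique)
  show "f x + inner (gradient f x) (z - x) \<le> f z" using g by simp
  let ?N = "(norm (z - x))\<^sup>2"
  let ?u = "\<lambda>t. f x + inner g (z - x) + L * t * ?N + (1 - t) * L / 2 * ?N"
  \<comment> \<open>The crude bound is applied at a point a fraction \<open>t\<close> of the way
    from \<open>x\<close> to \<open>z\<close>. After division by \<open>t\<close> its contribution
    is of order \<open>t\<close>, so only the smoothness term with \<open>L / 2\<close> survives as
    \<open>t\<close> tends to 0.\<close>
  have "f z \<le> ?u t" if t: "0 < t" "t < 1" for t
  proof -
    let ?y = "(1 - t) *\<^sub>R x + t *\<^sub>R z"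
    have y: "?y - x = t *\<^sub>R (z - x)" by (simp add: algebra_simps)
    have "(1 - t) * f x + t * f z \<le> f ?y + t * (1 - t) * L / 2 * ?N"
      using smooth[of t x z] t by (simp add: norm_minus_commute)
    also have "f ?y \<le> f x + t * inner g (z - x) + L * (t\<^sup>2 * ?N)"
      using upper[of ?y] unfolding y by (simp add: power_mult_distrib)
    finally have "t * f z \<le> t * ?u t"
      by (simp add: algebra_simps power2_eq_square)
    then show ?thesis using t by simp
  qed
  then have "\<forall>\<^sub>F t in at_right 0. f z \<le> ?u t"
    unfolding eventually_at_right[OF zero_less_one] by (intro exI[of _ 1]) auto
  moreover have "(?u \<longlongrightarrow> f x + inner g (z - x) + L * 0 * ?N + (1 - 0) * L / 2 * ?N) (at_right 0)"
    by (intro tendsto_intros) simp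
  ultimately have "f z \<le> f x + inner g (z - x) + L * 0 * ?N + (1 - 0) * L / 2 * ?N"
    by (intro tendsto_lowerbound[of ?u _ "at_right 0"]) auto
  then show "f z \<le> f x + inner (gradient f x) (z - x) + L / 2 * (norm (z - x))\<^sup>2"
    by simp
qed

text \<open>Here \<open>c\<close> stands for the conjugate of \<phi> at \<open>y\<close> and
  \<open>g\<close> for the gradient at \<open>x\<close>. The quadratic upper bound on \<phi> bounds
  the conjugate from below once a good \<open>z\<close> is inserted.\<close>

lemma fenchel_dual_gap:
  assumes "L > 0"
    and lower: "\<And>z. inner z y - \<phi> z \<le> c"
    and upper: "\<And>z. \<phi> z \<le> \<phi> x + inner g (z - x) + L / 2 * (norm (z - x))\<^sup>2"
  shows "(norm (g - y))\<^sup>2 \<le> 2 * L * (\<phi> x + c - inner x y)"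
proof -
  \<comment> \<open>This is the maximiser of \<open>inner z y\<close> minus the quadratic upper
    bound: it solves \<open>g + L *\<^sub>R (z - x) = y\<close>.\<close>
  define z where "z = x + (1 / L) *\<^sub>R (y - g)"
  have zx: "z - x = (1 / L) *\<^sub>R (y - g)" by (simp add: z_def)
  have "L / 2 * (norm (z - x))\<^sup>2 = (1 / (2 * L)) * (norm (g - y))\<^sup>2"
    unfolding zx norm_scaleR using \<open>L > 0\<close>
    by (simp add: norm_minus_commute power_mult_distrib power2_eq_square)
  moreover have "inner g (z - x) = inner z y - inner x y - (1 / L) * (norm (g - y))\<^sup>2"
    using \<open>L > 0\<close> unfolding z_def power2_norm_eq_inner
    by (simp add: inner_add_left inner_diff_left inner_diff_right inner_commute[of y g] field_simps)
  ultimately have "(1 / L) * (norm (g - y))\<^sup>2 - (1 / (2 * L)) * (norm (g - y))\<^sup>2 \<le> \<phi> x + c - inner x y"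
    using lower[of z] upper[of z] by linarith
  then show ?thesis using \<open>L > 0\<close> by (simp add: field_simps)
qed

section \<open>Square-integrable functions\<close>

definition square_integrable :: "'m measure \<Rightarrow> ('m \<Rightarrow> 'a::euclidean_space) \<Rightarrow> bool" where
  "square_integrable M f \<longleftrightarrow> f \<in> borel_measurable M \<and> integrable M (\<lambda>x. (norm (f x))\<^sup>2)"

text \<open>The Bochner integral of a non-integrable function is 0, so the value is the L2 norm only
  for functions that are \<open>square_integrable\<close>.\<close>

definition l2 :: "'m measure \<Rightarrow> ('m \<Rightarrow> 'a::euclidean_space) \<Rightarrow> real" where
  "l2 M f = sqrt (\<integral>x. (norm (f x))\<^sup>2 \<partial>M)"

lemma l2_nonneg: "0 \<le> l2 M f"
  by (simp add: l2_def)

lemma l2_power2: "(l2 M f)\<^sup>2 = (\<integral>x. (norm (f x))\<^sup>2 \<partial>M)"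
  by (simp add: l2_def)

lemma l2_mono:
  assumes "square_integrable M f" "square_integrable M g" "AE x in M. norm (f x) \<le> norm (g x)"
  shows "l2 M f \<le> l2 M g"
  unfolding l2_def
proof (intro real_sqrt_le_mono integral_mono_AE)
  show "AE x in M. (norm (f x))\<^sup>2 \<le> (norm (g x))\<^sup>2"
    using assms(3) by eventually_elim (auto intro: power_mono)
qed (use assms in \<open>auto simp: square_integrable_def\<close>)

lemma square_integrable_inner:
  assumes "square_integrable M f" "square_integrable M g"
  shows "integrable M (\<lambda>x. inner (f x) (g x))"
proof (rule Bochner_Integration.integrable_bound)
  show "integrable M (\<lambda>x. (norm (f x))\<^sup>2 + (norm (g x))\<^sup>2)"
    using assms by (auto simp: square_integrable_def)
  show "(\<lambda>x. inner (f x) (g x)) \<in> borel_measurable M"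
    using assms by (auto simp: square_integrable_def)
  show "AE x in M. norm (inner (f x) (g x)) \<le> norm ((norm (f x))\<^sup>2 + (norm (g x))\<^sup>2)"
  proof (rule AE_I2)
    fix x
    have "\<bar>inner (f x) (g x)\<bar> \<le> norm (f x) * norm (g x)" by (rule Cauchy_Schwarz_ineq2)
    also have "\<dots> \<le> (norm (f x))\<^sup>2 + (norm (g x))\<^sup>2"
      using sum_squares_bound[of "norm (f x)" "norm (g x)"]
        mult_nonneg_nonneg[OF norm_ge_zero[of "f x"] norm_ge_zero[of "g x"]]
      unfolding mult.assoc by linarith
    finally show "norm (inner (f x) (g x)) \<le> norm ((norm (f x))\<^sup>2 + (norm (g x))\<^sup>2)" by simp
  qed
qed

lemma square_integrable_add:
  assumes "square_integrable M f" "square_integrable M g"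
  shows "square_integrable M (\<lambda>x. f x + g x)"
proof -
  have "integrable M (\<lambda>x. (norm (f x))\<^sup>2 + 2 * inner (f x) (g x) + (norm (g x))\<^sup>2)"
    using assms square_integrable_inner[OF assms] by (auto simp: square_integrable_def)
  then have "integrable M (\<lambda>x. (norm (f x + g x))\<^sup>2)"
    by (simp add: power2_norm_eq_inner inner_add_left inner_add_right inner_commute algebra_simps)
  then show ?thesis using assms by (auto simp: square_integrable_def)
qed

lemma square_integrable_minus:
  "square_integrable M f \<Longrightarrow> square_integrable M (\<lambda>x. - f x)"
  by (simp add: square_integrable_def)

lemma square_integrable_diff:
  assumes "square_integrable M f" "square_integrable M g"
  shows "square_integrable M (\<lambda>x. f x - g x)"
  using square_integrable_add[OF assms(1) square_integrable_minus[OF assms(2)]] by simp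

lemma square_integrable_norm:
  "square_integrable M f \<Longrightarrow> square_integrable M (\<lambda>x. norm (f x))"
  by (auto simp: square_integrable_def)

lemma (in finite_measure) square_integrable_const: "square_integrable M (\<lambda>x. c)"
  by (simp add: square_integrable_def)

lemma square_integrable_Pair:
  assumes "square_integrable M f" "square_integrable M g"
  shows "square_integrable M (\<lambda>x. (f x, g x))"
  using assms by (auto simp: square_integrable_def norm_Pair)

text \<open>Cauchy-Schwarz, from the nonnegativity of a quadratic form. Keeping both coefficients
  \<open>t\<close> and \<open>s\<close> avoids a division by the norm of \<open>g\<close>.\<close>

lemma inner_le_l2_mult:
  fixes f g :: "'m \<Rightarrow> 'a::euclidean_space"
  assumes f: "square_integrable M f" and g: "square_integrable M g"
  shows "(\<integral>x. inner (f x) (g x) \<partial>M) \<le> l2 M f * l2 M g"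
proof -
  let ?A = "(l2 M f)\<^sup>2" and ?B = "(l2 M g)\<^sup>2" and ?I = "\<integral>x. inner (f x) (g x) \<partial>M"
  have norm_sq: "(norm (t *\<^sub>R a - s *\<^sub>R b))\<^sup>2
      = t\<^sup>2 * (norm a)\<^sup>2 - 2 * t * s * inner a b + s\<^sup>2 * (norm b)\<^sup>2" for t s and a b :: 'a
    unfolding power2_norm_eq_inner
    by (simp add: inner_diff_left inner_diff_right inner_commute[of b a] power2_eq_square[of t]
      power2_eq_square[of s] algebra_simps)
  have quad: "0 \<le> t\<^sup>2 * ?A - 2 * t * s * ?I + s\<^sup>2 * ?B" for t s
  proof -
    have "0 \<le> (\<integral>x. (norm (t *\<^sub>R f x - s *\<^sub>R g x))\<^sup>2 \<partial>M)" by simp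
    also have "\<dots> = (\<integral>x. t\<^sup>2 * (norm (f x))\<^sup>2 - 2 * t * s * inner (f x) (g x) + s\<^sup>2 * (norm (g x))\<^sup>2 \<partial>M)"
      by (simp only: norm_sq)
    also have "\<dots> = t\<^sup>2 * ?A - 2 * t * s * ?I + s\<^sup>2 * ?B"
      using f g square_integrable_inner[OF f g]
      by (simp add: l2_power2 square_integrable_def)
    finally show ?thesis .
  qed
  have "?I\<^sup>2 \<le> ?A * ?B"
  proof (cases "?B = 0")
    case True
    have "?I = 0"
    proof (rule ccontr)
      assume "?I \<noteq> 0"
      \<comment> \<open>With \<open>?B = 0\<close> the form is affine in \<open>s\<close>; this
        choice of \<open>s\<close> gives it the value -1.\<close>
      have "0 \<le> ?A - 2 * ((?A + 1) / (2 * ?I)) * ?I" using quad[of 1 "(?A + 1) / (2 * ?I)"] True by simp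
      with \<open>?I \<noteq> 0\<close> show False by simp
    qed
    then show ?thesis by simp
  next
    case False
    have "0 \<le> ?B * (?A * ?B - ?I\<^sup>2)"
      using quad[of ?B ?I] by (simp add: algebra_simps power2_eq_square)
    moreover have "?B > 0" using False by simp
    ultimately have "0 \<le> ?A * ?B - ?I\<^sup>2" by (simp only: zero_le_mult_iff) linarith
    then show ?thesis by simp
  qed
  then have "?I\<^sup>2 \<le> (l2 M f * l2 M g)\<^sup>2" by (simp add: power_mult_distrib)
  then show ?thesis by (rule power2_le_imp_le) (simp add: l2_nonneg)
qed

lemma l2_diff_power2:
  assumes "square_integrable M f" "square_integrable M g"
  shows "(l2 M (\<lambda>x. f x - g x))\<^sup>2 = (l2 M f)\<^sup>2 - 2 * (\<integral>x. inner (f x) (g x) \<partial>M) + (l2 M g)\<^sup>2"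
proof -
  have "(l2 M (\<lambda>x. f x - g x))\<^sup>2
      = (\<integral>x. (norm (f x))\<^sup>2 - 2 * inner (f x) (g x) + (norm (g x))\<^sup>2 \<partial>M)"
    unfolding l2_power2
    by (intro Bochner_Integration.integral_cong refl)
      (simp add: power2_norm_eq_inner inner_diff_left inner_diff_right inner_commute)
  also have "\<dots> = (l2 M f)\<^sup>2 - 2 * (\<integral>x. inner (f x) (g x) \<partial>M) + (l2 M g)\<^sup>2"
    using assms square_integrable_inner[OF assms] by (simp add: l2_power2 square_integrable_def)
  finally show ?thesis .
qed

lemma l2_triangle:
  assumes f: "square_integrable M f" and g: "square_integrable M g"
  shows "l2 M (\<lambda>x. f x + g x) \<le> l2 M f + l2 M g"
proof -
  have "(l2 M (\<lambda>x. f x + g x))\<^sup>2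
      = (\<integral>x. (norm (f x))\<^sup>2 + 2 * inner (f x) (g x) + (norm (g x))\<^sup>2 \<partial>M)"
    unfolding l2_power2
    by (intro Bochner_Integration.integral_cong refl)
      (simp add: power2_norm_eq_inner inner_add_left inner_add_right inner_commute)
  also have "\<dots> = (l2 M f)\<^sup>2 + 2 * (\<integral>x. inner (f x) (g x) \<partial>M) + (l2 M g)\<^sup>2"
    using f g square_integrable_inner[OF f g] by (simp add: l2_power2 square_integrable_def)
  also have "\<dots> \<le> (l2 M f + l2 M g)\<^sup>2"
    using inner_le_l2_mult[OF f g] by (simp add: power2_sum)
  finally show ?thesis by (rule power2_le_imp_le) (simp add: l2_nonneg)
qed

lemma l2_triangle_diff:
  assumes "square_integrable M f" "square_integrable M g" "square_integrable M h"
  shows "l2 M (\<lambda>x. f x - h x) \<le> l2 M (\<lambda>x. f x - g x) + l2 M (\<lambda>x. g x - h x)"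
  using l2_triangle[of M "\<lambda>x. f x - g x" "\<lambda>x. g x - h x"] assms
  by (simp add: square_integrable_diff)

lemma l2_minus_commute: "l2 M (\<lambda>x. f x - g x) = l2 M (\<lambda>x. g x - f x)"
  by (simp add: l2_def norm_minus_commute)

lemma (in prob_space) l2_const: "l2 M (\<lambda>x. c) = norm c"
  by (simp add: l2_def prob_space)

lemma square_integrable_distr:
  assumes "h \<in> measurable M N" "f \<in> borel_measurable N"
  shows "square_integrable (distr M N h) f \<longleftrightarrow> square_integrable M (\<lambda>x. f (h x))"
  using assms by (simp add: square_integrable_def integrable_distr_eq)

lemma l2_distr:
  assumes "h \<in> measurable M N" "f \<in> borel_measurable N"
  shows "l2 (distr M N h) f = l2 M (\<lambda>x. f (h x))"
  using assms by (simp add: l2_def integral_distr)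

section \<open>Couplings and the Wasserstein distance\<close>

text \<open>Approximate gluing. Since \<open>f\<close> and \<open>g\<close> have the same law, each
  cell has the same mass \<open>m n\<close> under \<open>P\<close> and under \<open>Q\<close>; this
  is why one density corrects both marginals of the product measure.\<close>

lemma near_coupling:
  fixes f :: "'a \<Rightarrow> 'c::{metric_space, second_countable_topology}" and g :: "'b \<Rightarrow> 'c"
  assumes P: "prob_space P" and Q: "prob_space Q"
    and f [measurable]: "f \<in> borel_measurable P" and g [measurable]: "g \<in> borel_measurable Q"
    and eq: "distr P borel f = distr Q borel g" and "\<delta> > 0"
  obtains R where "sets R = sets (P \<Otimes>\<^sub>M Q)" "distr R P fst = P" "distr R Q snd = Q"
    "AE z in R. dist (f (fst z)) (g (snd z)) \<le> \<delta>"
proof -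
  interpret P: prob_space P by fact
  interpret Q: prob_space Q by fact
  obtain D :: "'c set" where D: "countable D" "\<And>X. open X \<Longrightarrow> X \<noteq> {} \<Longrightarrow> \<exists>d\<in>D. d \<in> X"
    using countable_dense_setE by blast
  have "D \<noteq> {}" using D(2)[of UNIV] by auto
  define d where "d = from_nat_into D"
  define near where "near n x \<longleftrightarrow> dist (d n) x < \<delta> / 2" for n x
  \<comment> \<open>The cells are the level sets of \<open>k\<close>. Each lies in a ball of radius
    \<open>\<delta> / 2\<close> around a point of the dense set.\<close>
  define k where "k x = (LEAST n. near n x)" for x
  have ex: "\<exists>n. near n x" for x
  proof -
    obtain y where "y \<in> D" "y \<in> ball x (\<delta> / 2)"
      using D(2)[of "ball x (\<delta> / 2)"] \<open>\<delta> > 0\<close> by auto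
    then show ?thesis unfolding near_def d_def
      by (metis D(1) from_nat_into_to_nat_on dist_commute mem_ball)
  qed
  have close: "dist x y \<le> \<delta>" if "k x = k y" for x y
  proof -
    have "near (k x) x" "near (k x) y"
      using LeastI_ex[OF ex[of x]] LeastI_ex[OF ex[of y]] that by (auto simp: k_def)
    then show ?thesis unfolding near_def
      using dist_triangle3[of x y "d (k x)"] by simp
  qed
  have [measurable]: "Measurable.pred borel (near n)" for n
    unfolding near_def by measurable
  have k [measurable]: "k \<in> measurable borel (count_space UNIV)"
    unfolding k_def by measurable
  define m where "m n = emeasure (distr P borel f) {x. k x = n}" for n
  have mP: "m n = emeasure P {a\<in>space P. k (f a) = n}" for n
    unfolding m_def by (subst emeasure_distr) (auto intro!: arg_cong[where f="emeasure P"])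
  have mQ: "m n = emeasure Q {b\<in>space Q. k (g b) = n}" for n
    unfolding m_def eq by (subst emeasure_distr) (auto intro!: arg_cong[where f="emeasure Q"])
  have mfin: "m n \<noteq> \<infinity>" for n
    unfolding mP by simp
  \<comment> \<open>Given the cell of a partition into sets of diameter at most \<open>\<delta>\<close>, the two coordinates are made
    independent. Cells of mass \<open>0\<close> make the density \<open>\<infinity>\<close>, but only on a null set.\<close>
  define w where "w z = (if k (f (fst z)) = k (g (snd z)) then 1 / m (k (f (fst z))) else 0)" for z
  have [measurable]: "(\<lambda>z. k (f (fst z))) \<in> measurable (P \<Otimes>\<^sub>M Q) (count_space UNIV)"
    "(\<lambda>z. k (g (snd z))) \<in> measurable (P \<Otimes>\<^sub>M Q) (count_space UNIV)" by measurable
  have [measurable]: "(\<lambda>z. 1 / m (k (f (fst z)))) \<in> borel_measurable (P \<Otimes>\<^sub>M Q)"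
    by (rule measurable_compose[where N="count_space UNIV" and f="\<lambda>z. k (f (fst z))"]) simp_all
  \<comment> \<open>Equality of the two cell indices is written as a countable union, from which
    measurability is immediate.\<close>
  have "Measurable.pred (P \<Otimes>\<^sub>M Q) (\<lambda>z. \<exists>n. k (g (snd z)) = n \<and> k (f (fst z)) = n)"
    by measurable
  then have [measurable]: "Measurable.pred (P \<Otimes>\<^sub>M Q) (\<lambda>z. k (f (fst z)) = k (g (snd z)))"
    by simp
  have w [measurable]: "w \<in> borel_measurable (P \<Otimes>\<^sub>M Q)"
    unfolding w_def by measurable
  define R where "R = density (P \<Otimes>\<^sub>M Q) w"
  have sets_R [measurable_cong]: "sets R = sets (P \<Otimes>\<^sub>M Q)" by (simp add: R_def)
  \<comment> \<open>There are countably many cells, so those of mass 0 together form a null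
    set.\<close>
  have posP: "AE a in P. m (k (f a)) \<noteq> 0"
  proof -
    have "AE a in P. \<forall>n. m n = 0 \<longrightarrow> k (f a) \<noteq> n"
      unfolding AE_all_countable
    proof
      fix n show "AE a in P. m n = 0 \<longrightarrow> k (f a) \<noteq> n"
      proof (cases "m n = 0")
        case True
        then show ?thesis unfolding mP by (subst AE_iff_measurable[OF _ refl]) auto
      qed simp
    qed
    then show ?thesis by eventually_elim auto
  qed
  have posQ: "AE b in Q. m (k (g b)) \<noteq> 0"
  proof -
    have "AE b in Q. \<forall>n. m n = 0 \<longrightarrow> k (g b) \<noteq> n"
      unfolding AE_all_countable
    proof
      fix n show "AE b in Q. m n = 0 \<longrightarrow> k (g b) \<noteq> n"
      proof (cases "m n = 0")
        case True
        then show ?thesis unfolding mQ by (subst AE_iff_measurable[OF _ refl]) auto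
      qed simp
    qed
    then show ?thesis by eventually_elim auto
  qed
  interpret PQ: pair_sigma_finite P Q ..
  \<comment> \<open>On the fibre over \<open>a\<close> the density is constant on one cell of
    \<open>Q\<close>-mass \<open>m (k (f a))\<close>, which is finite and nonzero.\<close>
  have margP: "(\<integral>\<^sup>+ b. w (a, b) \<partial>Q) = 1" if "m (k (f a)) \<noteq> 0" "a \<in> space P" for a
  proof -
    have "(\<integral>\<^sup>+ b. w (a, b) \<partial>Q)
        = (\<integral>\<^sup>+ b. (1 / m (k (f a))) * indicator {b\<in>space Q. k (g b) = k (f a)} b \<partial>Q)"
      by (intro nn_integral_cong) (auto simp: w_def)
    also have "\<dots> = (1 / m (k (f a))) * m (k (f a))"
      unfolding mQ by (subst nn_integral_cmult_indicator) auto
    also have "\<dots> = 1" using that mfin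
      by (simp add: ennreal_divide_times ennreal_divide_self less_top)
    finally show ?thesis .
  qed
  have margQ: "(\<integral>\<^sup>+ a. w (a, b) \<partial>P) = 1" if "m (k (g b)) \<noteq> 0" "b \<in> space Q" for b
  proof -
    have "(\<integral>\<^sup>+ a. w (a, b) \<partial>P)
        = (\<integral>\<^sup>+ a. (1 / m (k (g b))) * indicator {a\<in>space P. k (f a) = k (g b)} a \<partial>P)"
      by (intro nn_integral_cong) (auto simp: w_def)
    also have "\<dots> = (1 / m (k (g b))) * m (k (g b))"
      unfolding mP by (subst nn_integral_cmult_indicator) auto
    also have "\<dots> = 1" using that mfin
      by (simp add: ennreal_divide_times ennreal_divide_self less_top)
    finally show ?thesis .
  qed
  have "distr R P fst = P"
  proof (rule measure_eqI)
    fix A assume "A \<in> sets (distr R P fst)"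
    then have A [measurable]: "A \<in> sets P" by simp
    have "emeasure (distr R P fst) A = emeasure R (A \<times> space Q)"
      using sets.sets_into_space[OF A]
      by (subst emeasure_distr) (auto simp: R_def space_pair_measure intro!: arg_cong[where f="emeasure _"])
    also have "\<dots> = (\<integral>\<^sup>+ z. w z * indicator (A \<times> space Q) z \<partial>(P \<Otimes>\<^sub>M Q))"
      unfolding R_def by (subst emeasure_density) auto
    also have "\<dots> = (\<integral>\<^sup>+ a. \<integral>\<^sup>+ b. w (a, b) * indicator (A \<times> space Q) (a, b) \<partial>Q \<partial>P)"
      by (subst Q.nn_integral_fst[symmetric]) auto
    also have "\<dots> = (\<integral>\<^sup>+ a. indicator A a * (\<integral>\<^sup>+ b. w (a, b) \<partial>Q) \<partial>P)"
      by (intro nn_integral_cong, subst nn_integral_cmult[symmetric])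
        (auto intro!: nn_integral_cong simp: indicator_def)
    also have "\<dots> = (\<integral>\<^sup>+ a. indicator A a \<partial>P)"
    proof (rule nn_integral_cong_AE)
      show "AE a in P. indicator A a * (\<integral>\<^sup>+ b. w (a, b) \<partial>Q) = indicator A a"
        using posP AE_space by eventually_elim (simp add: margP)
    qed
    finally show "emeasure (distr R P fst) A = emeasure P A" by simp
  qed simp
  moreover have "distr R Q snd = Q"
  proof (rule measure_eqI)
    fix B assume "B \<in> sets (distr R Q snd)"
    then have B [measurable]: "B \<in> sets Q" by simp
    have "emeasure (distr R Q snd) B = emeasure R (space P \<times> B)"
      using sets.sets_into_space[OF B]
      by (subst emeasure_distr) (auto simp: R_def space_pair_measure intro!: arg_cong[where f="emeasure _"])
    also have "\<dots> = (\<integral>\<^sup>+ z. w z * indicator (space P \<times> B) z \<partial>(P \<Otimes>\<^sub>M Q))"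
      unfolding R_def by (subst emeasure_density) auto
    also have "\<dots> = (\<integral>\<^sup>+ b. \<integral>\<^sup>+ a. w (a, b) * indicator (space P \<times> B) (a, b) \<partial>P \<partial>Q)"
      by (subst PQ.nn_integral_snd[symmetric]) (auto simp: case_prod_beta')
    also have "\<dots> = (\<integral>\<^sup>+ b. indicator B b * (\<integral>\<^sup>+ a. w (a, b) \<partial>P) \<partial>Q)"
      by (intro nn_integral_cong, subst nn_integral_cmult[symmetric])
        (auto intro!: nn_integral_cong simp: indicator_def)
    also have "\<dots> = (\<integral>\<^sup>+ b. indicator B b \<partial>Q)"
    proof (rule nn_integral_cong_AE)
      show "AE b in Q. indicator B b * (\<integral>\<^sup>+ a. w (a, b) \<partial>P) = indicator B b"
        using posQ AE_space by eventually_elim (simp add: margQ)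
    qed
    finally show "emeasure (distr R Q snd) B = emeasure Q B" by simp
  qed simp
  \<comment> \<open>The density vanishes on pairs from different cells.\<close>
  moreover have "AE z in R. dist (f (fst z)) (g (snd z)) \<le> \<delta>"
    unfolding R_def AE_density[OF w] by (rule AE_I2) (auto simp: w_def intro: close split: if_splits)
  ultimately show ?thesis using that sets_R by blast
qed

section \<open>Transport plans and \<open>W2\<close> through random variables\<close>

lemma square_integrable_law:
  assumes "distr M borel X \<in> P2" "X \<in> borel_measurable M"
  shows "square_integrable M X"
  using assms by (simp add: P2_def square_integrable_def integrable_distr_eq)

text \<open>The measure \<open>borel\<close> on a product type equals the product of the
  \<open>borel\<close> measures, but not syntactically; the projections are therefore treated
  separately.\<close>

lemma measurable_fst_snd_borel [measurable]:
  "fst \<in> borel_measurable (borel :: ('a::euclidean_space \<times> 'a) measure)"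
  "snd \<in> borel_measurable (borel :: ('a::euclidean_space \<times> 'a) measure)"
  by (simp_all flip: borel_prod)

lemma transport_planD:
  assumes "\<alpha> \<in> transport_plans \<mu> \<nu>"
  shows "prob_space \<alpha>" "sets \<alpha> = sets borel" "distr \<alpha> borel fst = \<mu>" "distr \<alpha> borel snd = \<nu>"
    "fst \<in> borel_measurable \<alpha>" "snd \<in> borel_measurable \<alpha>"
proof -
  show *: "prob_space \<alpha>" "sets \<alpha> = sets borel" "distr \<alpha> borel fst = \<mu>" "distr \<alpha> borel snd = \<nu>"
    using assms by (auto simp: transport_plans_def)
  show "fst \<in> borel_measurable \<alpha>" "snd \<in> borel_measurable \<alpha>"
    using measurable_fst_snd_borel by (auto simp: measurable_cong_sets[OF *(2) refl])
qed

text \<open>The second moments of the marginals make every plan's cost finite, so nothing is lost in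
  passing from \<open>ennreal\<close> to \<open>real\<close>.\<close>

lemma transport_cost_plan:
  assumes "\<alpha> \<in> transport_plans \<mu> \<nu>" "\<mu> \<in> P2" "\<nu> \<in> P2"
  shows "square_integrable \<alpha> fst" "square_integrable \<alpha> snd"
    "transport_cost \<alpha> = ennreal ((l2 \<alpha> (\<lambda>z. fst z - snd z))\<^sup>2)"
proof -
  note \<alpha> = transport_planD[OF assms(1)]
  show *: "square_integrable \<alpha> fst" "square_integrable \<alpha> snd"
    using \<alpha> assms by (auto intro: square_integrable_law)
  have "integrable \<alpha> (\<lambda>z. (norm (fst z - snd z))\<^sup>2)"
    using square_integrable_diff[OF *] by (simp add: square_integrable_def)
  then show "transport_cost \<alpha> = ennreal ((l2 \<alpha> (\<lambda>z. fst z - snd z))\<^sup>2)"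
    unfolding transport_cost_def l2_power2 by (simp add: nn_integral_eq_integral)
qed

text \<open>The joint law of \<open>(X, Y)\<close> is a competitor in the infimum.\<close>

lemma W2_le_l2:
  fixes X Y :: "'m \<Rightarrow> 'a::euclidean_space"
  assumes "prob_space M" "square_integrable M X" "square_integrable M Y"
  shows "W2 (distr M borel X) (distr M borel Y) \<le> l2 M (\<lambda>w. X w - Y w)"
proof -
  interpret prob_space M by fact
  have [measurable]: "X \<in> borel_measurable M" "Y \<in> borel_measurable M"
    using assms by (auto simp: square_integrable_def)
  let ?\<alpha> = "distr M borel (\<lambda>w. (X w, Y w))"
  have plan: "?\<alpha> \<in> transport_plans (distr M borel X) (distr M borel Y)"
    unfolding transport_plans_def
    by (auto simp: distr_distr o_def intro!: prob_space_distr)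
  have "integrable M (\<lambda>w. (norm (X w - Y w))\<^sup>2)"
    using square_integrable_diff[OF assms(2,3)] by (simp add: square_integrable_def)
  then have cost: "transport_cost ?\<alpha> = ennreal ((l2 M (\<lambda>w. X w - Y w))\<^sup>2)"
    unfolding transport_cost_def l2_power2
    by (subst nn_integral_distr) (auto simp: nn_integral_eq_integral)
  have "enn2real (INF \<gamma>\<in>transport_plans (distr M borel X) (distr M borel Y). transport_cost \<gamma>)
      \<le> enn2real (ennreal ((l2 M (\<lambda>w. X w - Y w))\<^sup>2))"
    unfolding cost[symmetric]
    by (rule enn2real_mono[OF INF_lower[OF plan]]) (simp add: cost)
  then have "W2 (distr M borel X) (distr M borel Y)
      \<le> sqrt (enn2real (ennreal ((l2 M (\<lambda>w. X w - Y w))\<^sup>2)))"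
    unfolding W2_def by (rule real_sqrt_le_mono)
  then show ?thesis by (simp add: l2_nonneg)
qed

lemma W2_nonneg: "0 \<le> W2 \<mu> \<nu>"
  by (simp add: W2_def)

text \<open>The independent coupling serves to show that the infimum defining \<open>W2\<close> is
  finite.\<close>

lemma product_transport_plan:
  fixes \<mu> \<nu> :: "'a::euclidean_space measure"
  assumes "\<mu> \<in> P2" "\<nu> \<in> P2"
  shows "\<mu> \<Otimes>\<^sub>M \<nu> \<in> transport_plans \<mu> \<nu>"
proof -
  interpret \<mu>: prob_space \<mu> using assms by (simp add: P2_def)
  interpret \<nu>: prob_space \<nu> using assms by (simp add: P2_def)
  have s: "sets \<mu> = sets borel" "sets \<nu> = sets borel" using assms by (simp_all add: P2_def)
  have "sets (\<mu> \<Otimes>\<^sub>M \<nu>) = sets borel"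
    using sets_pair_measure_cong[OF s] unfolding borel_prod .
  moreover have "prob_space (\<mu> \<Otimes>\<^sub>M \<nu>)" 
    by (rule prob_space_pair[OF \<mu>.prob_space_axioms \<nu>.prob_space_axioms])
  moreover have "distr (\<mu> \<Otimes>\<^sub>M \<nu>) borel fst = \<mu>"
  proof -
    have "distr (\<mu> \<Otimes>\<^sub>M \<nu>) borel fst = distr (\<mu> \<Otimes>\<^sub>M \<nu>) \<mu> fst"
      by (rule distr_cong[OF refl s(1)[symmetric] refl])
    also have "\<dots> = \<mu>" by (rule \<nu>.distr_pair_fst)
    finally show ?thesis .
  qed
  moreover have "distr (\<mu> \<Otimes>\<^sub>M \<nu>) borel snd = \<nu>"
  proof (rule measure_eqI)
    fix A assume "A \<in> sets (distr (\<mu> \<Otimes>\<^sub>M \<nu>) borel snd)"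
    then have A: "A \<in> sets \<nu>" using s by simp
    have "snd -` A \<inter> space (\<mu> \<Otimes>\<^sub>M \<nu>) = space \<mu> \<times> A"
      using sets.sets_into_space[OF A] by (auto simp: space_pair_measure)
    moreover have "snd \<in> borel_measurable (\<mu> \<Otimes>\<^sub>M \<nu>)"
      using measurable_snd[of \<mu> \<nu>] by (simp add: measurable_cong_sets[OF refl s(2)])
    moreover have "emeasure (\<mu> \<Otimes>\<^sub>M \<nu>) (space \<mu> \<times> A) = emeasure \<nu> A"
      using \<nu>.emeasure_pair_measure_Times[OF sets.top A, of \<mu>] by (simp add: \<mu>.emeasure_space_1)
    ultimately show "emeasure (distr (\<mu> \<Otimes>\<^sub>M \<nu>) borel snd) A = emeasure \<nu> A"
      using A s(2) by (simp add: emeasure_distr)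
  qed (use s in simp)
  ultimately show ?thesis by (simp add: transport_plans_def)
qed

text \<open>The infimum is finite, so it equals the square of \<open>W2\<close> and is approached by
  plans. Near-minimisers take the place of an optimal plan, whose existence would need a compactness
  argument.\<close>

lemma near_optimal_plan:
  assumes "\<mu> \<in> P2" "\<nu> \<in> P2" "\<delta> > 0"
  obtains \<alpha> where "\<alpha> \<in> transport_plans \<mu> \<nu>" "l2 \<alpha> (\<lambda>z. fst z - snd z) \<le> W2 \<mu> \<nu> + \<delta>"
proof -
  let ?I = "INF \<gamma>\<in>transport_plans \<mu> \<nu>. transport_cost \<gamma>"
  have "?I \<le> transport_cost (\<mu> \<Otimes>\<^sub>M \<nu>)"
    by (rule INF_lower) (rule product_transport_plan[OF assms(1,2)])
  also have "\<dots> < \<top>"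
    using transport_cost_plan(3)[OF product_transport_plan[OF assms(1,2)] assms(1,2)] by simp
  finally have fin: "?I < \<top>" .
  have "?I = ennreal ((W2 \<mu> \<nu>)\<^sup>2)" using fin by (simp add: W2_def)
  also have "\<dots> < ennreal ((W2 \<mu> \<nu> + \<delta>)\<^sup>2)"
    using \<open>\<delta> > 0\<close> W2_nonneg[of \<mu> \<nu>] by (intro ennreal_lessI power_strict_mono) auto
  finally obtain \<alpha> where \<alpha>: "\<alpha> \<in> transport_plans \<mu> \<nu>" "transport_cost \<alpha> < ennreal ((W2 \<mu> \<nu> + \<delta>)\<^sup>2)"
    by (auto simp: INF_less_iff)
  have "(l2 \<alpha> (\<lambda>z. fst z - snd z))\<^sup>2 < (W2 \<mu> \<nu> + \<delta>)\<^sup>2"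
    using \<alpha>(2) unfolding transport_cost_plan(3)[OF \<alpha>(1) assms(1,2)]
    by (rule ennreal_less_iff[THEN iffD1, OF zero_le_power2])
  then have "l2 \<alpha> (\<lambda>z. fst z - snd z) < W2 \<mu> \<nu> + \<delta>"
    by (rule power2_less_imp_less) (use \<open>\<delta> > 0\<close> W2_nonneg[of \<mu> \<nu>] in simp)
  then have "l2 \<alpha> (\<lambda>z. fst z - snd z) \<le> W2 \<mu> \<nu> + \<delta>" by simp
  with \<alpha>(1) show ?thesis by (rule that)
qed

text \<open>The building block for multi-coordinate couplings: a probability space is enlarged by a
  point of law \<mu> placed almost optimally relative to \<open>X\<close>. One half of \<delta> pays
  for the plan \<alpha> not being optimal, the other for gluing \<alpha> to \<open>M\<close> along
  \<open>X\<close> only approximately.\<close>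

lemma attach_near_optimal:
  fixes X :: "'m \<Rightarrow> 'a::euclidean_space"
  assumes M: "prob_space M" and X [measurable]: "X \<in> borel_measurable M"
    and P2: "distr M borel X \<in> P2" "\<mu> \<in> P2" and "\<delta> > 0"
  obtains N :: "('m \<times> 'a) measure" where "prob_space N" "sets N = sets (M \<Otimes>\<^sub>M borel)"
    "distr N M fst = M" "distr N borel snd = \<mu>"
    "l2 N (\<lambda>z. X (fst z) - snd z) \<le> W2 (distr M borel X) \<mu> + \<delta>"
proof -
  interpret M: prob_space M by fact
  obtain \<alpha> where \<alpha>: "\<alpha> \<in> transport_plans (distr M borel X) \<mu>"
      "l2 \<alpha> (\<lambda>z. fst z - snd z) \<le> W2 (distr M borel X) \<mu> + \<delta> / 2"
    using near_optimal_plan[OF P2, of "\<delta> / 2"] \<open>\<delta> > 0\<close> by auto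
  note \<alpha>' = transport_planD[OF \<alpha>(1)]
  note [measurable] = \<alpha>'(5,6)
  obtain R where R: "sets R = sets (M \<Otimes>\<^sub>M \<alpha>)" "distr R M fst = M" "distr R \<alpha> snd = \<alpha>"
      "AE z in R. dist (X (fst z)) (fst (snd z)) \<le> \<delta> / 2"
    using near_coupling[OF M \<alpha>'(1) X \<alpha>'(5), of "\<delta> / 2"] \<alpha>'(3) \<open>\<delta> > 0\<close> by auto
  note [measurable_cong] = R(1)
  have [measurable]: "fst \<in> measurable R M" "snd \<in> measurable R \<alpha>"
    by (simp_all add: measurable_cong_sets[OF R(1) refl])
  interpret R: prob_space R
    using prob_space_distrD[of fst R M] R(2) M by simp
  have X': "square_integrable R (\<lambda>z. X (fst z))"
    using square_integrable_law[OF P2(1) X] square_integrable_distr[of fst R M X] R(2) X by simp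
  have Y': "square_integrable R (\<lambda>z. fst (snd z))" "square_integrable R (\<lambda>z. snd (snd z))"
    using transport_cost_plan(1,2)[OF \<alpha>(1) P2] R(3)
      square_integrable_distr[of snd R \<alpha> fst] square_integrable_distr[of snd R \<alpha> snd] by simp_all
  \<comment> \<open>The first coordinate of \<alpha>, which is within \<open>\<delta> / 2\<close> of
    \<open>X\<close>, is forgotten.\<close>
  define N where "N = distr R (M \<Otimes>\<^sub>M borel) (\<lambda>z. (fst z, snd (snd z)))"
  have h [measurable]: "(\<lambda>z. (fst z, snd (snd z))) \<in> measurable R (M \<Otimes>\<^sub>M borel)"
    by measurable
  have "l2 R (\<lambda>z. X (fst z) - fst (snd z)) \<le> l2 R (\<lambda>_. \<delta> / 2)"
    using R(4) \<open>\<delta> > 0\<close>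
    by (intro l2_mono square_integrable_diff X' Y' R.square_integrable_const) (auto simp: dist_norm)
  then have 1: "l2 R (\<lambda>z. X (fst z) - fst (snd z)) \<le> \<delta> / 2"
    using \<open>\<delta> > 0\<close> by (simp add: R.l2_const)
  have 2: "l2 R (\<lambda>z. fst (snd z) - snd (snd z)) = l2 \<alpha> (\<lambda>z. fst z - snd z)"
    using l2_distr[of snd R \<alpha> "\<lambda>z. fst z - snd z"] R(3) by simp
  have "l2 N (\<lambda>z. X (fst z) - snd z) = l2 R (\<lambda>z. X (fst z) - snd (snd z))"
    unfolding N_def by (subst l2_distr[OF h]) simp_all
  also have "\<dots> \<le> W2 (distr M borel X) \<mu> + \<delta>"
    using l2_triangle_diff[OF X' Y'] 1 2 \<alpha>(2) by simp
  finally have "l2 N (\<lambda>z. X (fst z) - snd z) \<le> W2 (distr M borel X) \<mu> + \<delta>" .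
  moreover have "prob_space N" unfolding N_def by (intro R.prob_space_distr h)
  moreover have "distr N M fst = M"
    unfolding N_def by (subst distr_distr) (simp_all add: o_def R(2))
  moreover have "distr N borel snd = distr (distr R \<alpha> snd) borel snd"
    unfolding N_def by (subst (1 2) distr_distr) (simp_all add: o_def)
  then have "distr N borel snd = \<mu>" by (simp add: R(3) \<alpha>'(4))
  ultimately show ?thesis by (intro that) (simp_all add: N_def)
qed

section \<open>Symmetry and triangle inequality for \<open>W2\<close>\<close>

lemma W2_commute_le:
  assumes "\<mu> \<in> P2" "\<nu> \<in> P2"
  shows "W2 \<nu> \<mu> \<le> W2 \<mu> \<nu>"
proof (rule field_le_epsilon)
  fix \<delta> :: real assume "\<delta> > 0"
  obtain \<alpha> where \<alpha>: "\<alpha> \<in> transport_plans \<mu> \<nu>" "l2 \<alpha> (\<lambda>z. fst z - snd z) \<le> W2 \<mu> \<nu> + \<delta>"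
    using near_optimal_plan[OF assms \<open>\<delta> > 0\<close>] by blast
  have "W2 (distr \<alpha> borel snd) (distr \<alpha> borel fst) \<le> l2 \<alpha> (\<lambda>z. snd z - fst z)"
    by (intro W2_le_l2 transport_planD[OF \<alpha>(1)] transport_cost_plan[OF \<alpha>(1) assms])
  then show "W2 \<nu> \<mu> \<le> W2 \<mu> \<nu> + \<delta>"
    using \<alpha> transport_planD(3,4)[OF \<alpha>(1)] by (simp add: l2_minus_commute[of _ snd])
qed

lemma W2_commute: "\<mu> \<in> P2 \<Longrightarrow> \<nu> \<in> P2 \<Longrightarrow> W2 \<mu> \<nu> = W2 \<nu> \<mu>"
  by (intro antisym W2_commute_le)

text \<open>A point of law \<rho> is attached to the second coordinate of a nearly optimal plan from
  \<mu> to \<nu>; Minkowski's inequality on the enlarged space gives the bound up to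
  \<delta>.\<close>

lemma W2_triangle:
  assumes "\<mu> \<in> P2" "\<nu> \<in> P2" "\<rho> \<in> P2"
  shows "W2 \<mu> \<rho> \<le> W2 \<mu> \<nu> + W2 \<nu> \<rho>"
proof (rule field_le_epsilon)
  fix \<delta> :: real assume "\<delta> > 0"
  then have "\<delta> / 2 > 0" by simp
  obtain \<alpha> where \<alpha>: "\<alpha> \<in> transport_plans \<mu> \<nu>" "l2 \<alpha> (\<lambda>z. fst z - snd z) \<le> W2 \<mu> \<nu> + \<delta> / 2"
    using near_optimal_plan[OF assms(1,2) \<open>\<delta> / 2 > 0\<close>] by blast
  note \<alpha>' = transport_planD[OF \<alpha>(1)]
  obtain N where N: "prob_space N" "sets N = sets (\<alpha> \<Otimes>\<^sub>M borel)"
    "distr N \<alpha> fst = \<alpha>" "distr N borel snd = \<rho>"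
    "l2 N (\<lambda>z. snd (fst z) - snd z) \<le> W2 (distr \<alpha> borel snd) \<rho> + \<delta> / 2"
    by (rule attach_near_optimal[OF \<alpha>'(1,6) _ assms(3) \<open>\<delta> / 2 > 0\<close>]) (simp_all add: \<alpha>'(4) assms)
  have m: "fst \<in> measurable N \<alpha>" "snd \<in> borel_measurable N"
    by (simp_all add: measurable_cong_sets[OF N(2) refl])
  have sq: "square_integrable N (\<lambda>z. fst (fst z))" "square_integrable N (\<lambda>z. snd (fst z))"
    using transport_cost_plan(1,2)[OF \<alpha>(1) assms(1,2)] N(3) \<alpha>'(5,6)
      square_integrable_distr[OF m(1), of fst] square_integrable_distr[OF m(1), of snd] by simp_all
  have sq': "square_integrable N snd"
    using square_integrable_law[of N snd] N(4) assms(3) m(2) by simp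
  have "distr N borel (\<lambda>z. fst (fst z)) = distr (distr N \<alpha> fst) borel fst"
    by (subst distr_distr) (simp_all add: \<alpha>' m o_def)
  then have "distr N borel (\<lambda>z. fst (fst z)) = \<mu>" using N(3) \<alpha>'(3) by simp
  then have "W2 \<mu> \<rho> \<le> l2 N (\<lambda>z. fst (fst z) - snd z)"
    using W2_le_l2[OF N(1) sq(1) sq'] N(4) by simp
  also have "\<dots> \<le> l2 N (\<lambda>z. fst (fst z) - snd (fst z)) + l2 N (\<lambda>z. snd (fst z) - snd z)"
    by (intro l2_triangle_diff sq sq')
  also have "l2 N (\<lambda>z. fst (fst z) - snd (fst z)) = l2 \<alpha> (\<lambda>z. fst z - snd z)"
    using l2_distr[OF m(1), of "\<lambda>z. fst z - snd z"] N(3) \<alpha>'(5,6) by simp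
  finally show "W2 \<mu> \<rho> \<le> W2 \<mu> \<nu> + W2 \<nu> \<rho> + \<delta>" using \<alpha>(2) N(5) by (simp add: \<alpha>'(4))
qed

section \<open>Stability of transport plans\<close>

text \<open>The excess cost of \<open>(X, Y)\<close> over \<open>(X, T X)\<close>, with
  \<open>T\<close> the gradient, controls the distance from \<open>Y\<close> to \<open>T X\<close>.
  The pointwise Fenchel gap is integrated; as \<open>Y\<close> and \<open>T X\<close> have the same
  law, the integrals of the conjugate agree and the potentials cancel.\<close>

lemma transport_gap:
  fixes X Y :: "'m \<Rightarrow> 'a::euclidean_space" and \<phi> :: "'a \<Rightarrow> real"
  assumes "prob_space M" and sX: "square_integrable M X" and sY: "square_integrable M Y"
    and sTX: "square_integrable M (\<lambda>w. gradient \<phi> (X w))"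
    and "L > 0" and cvx: "convex_on UNIV \<phi>" and smooth: "lambda_smooth L \<phi>"
    and T [measurable]: "gradient \<phi> \<in> borel_measurable borel"
    and law: "distr M borel Y = distr M borel (\<lambda>w. gradient \<phi> (X w))"
  shows "(l2 M (\<lambda>w. gradient \<phi> (X w) - Y w))\<^sup>2
    \<le> L * ((l2 M (\<lambda>w. X w - Y w))\<^sup>2 - (l2 M (\<lambda>w. X w - gradient \<phi> (X w)))\<^sup>2)"
proof -
  interpret prob_space M by fact
  let ?T = "gradient \<phi>"
  have [measurable]: "X \<in> borel_measurable M" "Y \<in> borel_measurable M"
    using sX sY by (auto simp: square_integrable_def)
  note bounds = smooth_convex_gradient_bounds[OF cvx smooth]
  have cont: "continuous_on UNIV \<phi>" by (rule convex_on_continuous[OF open_UNIV cvx])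
  then have [measurable]: "\<phi> \<in> borel_measurable borel" by (rule borel_measurable_continuous_onI)
  obtain D :: "'a set" where D: "countable D" "\<And>U. open U \<Longrightarrow> U \<noteq> {} \<Longrightarrow> \<exists>d\<in>D. d \<in> U"
    using countable_dense_setE by blast
  \<comment> \<open>The Legendre transform of \<open>\<phi>\<close>; taking the supremum over a countable set makes it measurable.\<close>
  define \<psi> where "\<psi> y = (SUP z\<in>D. ereal (inner z y - \<phi> z))" for y
  \<comment> \<open>Where \<psi> is infinite this takes the default value 0, but \<open>fin\<close>
    below shows that \<open>Y\<close> almost surely avoids such points.\<close>
  define c where "c y = real_of_ereal (\<psi> y)" for y
  have [measurable]: "\<psi> \<in> borel_measurable borel"
    unfolding \<psi>_def using D(1) by measurable
  have [measurable]: "c \<in> borel_measurable borel"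
    unfolding c_def by measurable
  \<comment> \<open>By continuity of \<phi> a violation at \<open>z\<close> would persist on an open
    set, which meets \<open>D\<close>.\<close>
  have fenchel: "ereal (inner z y - \<phi> z) \<le> \<psi> y" for z y
  proof (rule ccontr)
    assume "\<not> ereal (inner z y - \<phi> z) \<le> \<psi> y"
    then have lt: "\<psi> y < ereal (inner z y - \<phi> z)" by simp
    let ?U = "{v. \<psi> y < ereal (inner v y - \<phi> v)}"
    have "continuous_on UNIV (\<lambda>v. ereal (inner v y - \<phi> v))"
      by (intro continuous_intros cont)
    then have "open ?U" by (rule open_Collect_less[OF continuous_on_const])
    then obtain d where "d \<in> D" "\<psi> y < ereal (inner d y - \<phi> d)"
      using D(2)[of ?U] lt by auto
    moreover have "ereal (inner d y - \<phi> d) \<le> \<psi> y"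
      unfolding \<psi>_def using \<open>d \<in> D\<close> by (rule SUP_upper)
    ultimately show False by simp
  qed
  \<comment> \<open>Equality in Fenchel-Young at the gradient: the tangent plane at \<open>x\<close>
    supports \<phi>, so the supremum is attained at \<open>x\<close>.\<close>
  have \<psi>T: "\<psi> (?T x) = ereal (inner x (?T x) - \<phi> x)" for x
  proof (rule antisym)
    show "\<psi> (?T x) \<le> ereal (inner x (?T x) - \<phi> x)"
      unfolding \<psi>_def
    proof (rule SUP_least)
      fix z
      show "ereal (inner z (?T x) - \<phi> z) \<le> ereal (inner x (?T x) - \<phi> x)"
        using bounds(1)[of x z] by (simp add: inner_diff_right inner_commute)
    qed
  qed (rule fenchel)
  have cT: "c (?T x) = inner x (?T x) - \<phi> x" for x by (simp add: c_def \<psi>T)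
  have lower: "inner z y - \<phi> z \<le> c y" if "\<psi> y \<noteq> \<infinity>" for z y
    using fenchel[of z y] that unfolding c_def by (cases "\<psi> y") auto
  \<comment> \<open>The tangent plane at 0 and the quadratic above it enclose \<phi>, so its growth
    is at most quadratic.\<close>
  have int_\<phi>: "integrable M (\<lambda>w. \<phi> (X w))"
  proof (rule Bochner_Integration.integrable_bound)
    show "integrable M (\<lambda>w. \<bar>\<phi> 0\<bar> + \<bar>inner (?T 0) (X w)\<bar> + L / 2 * (norm (X w))\<^sup>2)"
      using sX square_integrable_inner[OF square_integrable_const[of "?T 0"] sX]
      by (auto simp: square_integrable_def)
    show "AE w in M. norm (\<phi> (X w)) \<le> norm (\<bar>\<phi> 0\<bar> + \<bar>inner (?T 0) (X w)\<bar> + L / 2 * (norm (X w))\<^sup>2)"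
    proof (rule AE_I2)
      fix w
      have "0 \<le> L / 2 * (norm (X w))\<^sup>2" using \<open>L > 0\<close> by simp
      then show "norm (\<phi> (X w)) \<le> norm (\<bar>\<phi> 0\<bar> + \<bar>inner (?T 0) (X w)\<bar> + L / 2 * (norm (X w))\<^sup>2)"
        using bounds[where x=0 and z="X w"] unfolding real_norm_def diff_zero by linarith
    qed
  qed measurable
  have int_TX: "integrable M (\<lambda>w. inner (X w) (?T (X w)))"
    by (rule square_integrable_inner[OF sX sTX])
  have int_cT: "integrable M (\<lambda>w. c (?T (X w)))"
    unfolding cT using int_\<phi> int_TX by simp
  have "integrable (distr M borel Y) c"
    unfolding law using int_cT by (simp add: integrable_distr_eq)
  then have int_c: "integrable M (\<lambda>w. c (Y w))" by (simp add: integrable_distr_eq)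
  have "(\<integral>w. c (Y w) \<partial>M) = (\<integral>y. c y \<partial>distr M borel Y)"
    by (simp add: integral_distr)
  also have "\<dots> = (\<integral>w. c (?T (X w)) \<partial>M)"
    unfolding law by (simp add: integral_distr)
  also have "\<dots> = (\<integral>w. inner (X w) (?T (X w)) \<partial>M) - (\<integral>w. \<phi> (X w) \<partial>M)"
    unfolding cT using int_\<phi> int_TX by simp
  finally have c_eq: "(\<integral>w. c (Y w) \<partial>M)
      = (\<integral>w. inner (X w) (?T (X w)) \<partial>M) - (\<integral>w. \<phi> (X w) \<partial>M)" .
  \<comment> \<open>The conjugate is finite on the range of the gradient, and the law of
    \<open>Y\<close> is that of \<open>?T (X w)\<close>.\<close>
  have "AE y in distr M borel Y. \<psi> y \<noteq> \<infinity>"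
    unfolding law by (subst AE_distr_iff) (simp_all add: \<psi>T)
  then have fin: "AE w in M. \<psi> (Y w) \<noteq> \<infinity>"
    by (subst (asm) AE_distr_iff) simp_all
  have int_XY: "integrable M (\<lambda>w. inner (X w) (Y w))"
    by (rule square_integrable_inner[OF sX sY])
  have "(l2 M (\<lambda>w. ?T (X w) - Y w))\<^sup>2
      \<le> (\<integral>w. 2 * L * (\<phi> (X w) + c (Y w) - inner (X w) (Y w)) \<partial>M)"
    unfolding l2_power2
  proof (rule integral_mono_AE)
    show "AE w in M. (norm (?T (X w) - Y w))\<^sup>2 \<le> 2 * L * (\<phi> (X w) + c (Y w) - inner (X w) (Y w))"
      using fin
    proof eventually_elim
      case (elim w)
      show ?case
        by (rule fenchel_dual_gap[OF \<open>L > 0\<close> lower[OF elim] bounds(2)])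
    qed
  qed (use square_integrable_diff[OF sTX sY] int_\<phi> int_c int_XY in \<open>simp_all add: square_integrable_def\<close>)
  also have "\<dots> = 2 * L * ((\<integral>w. inner (X w) (?T (X w)) \<partial>M) - (\<integral>w. inner (X w) (Y w) \<partial>M))"
    using int_\<phi> int_c int_XY by (simp add: c_eq)
  also have "\<dots> = L * ((l2 M (\<lambda>w. X w - Y w))\<^sup>2 - (l2 M (\<lambda>w. X w - ?T (X w)))\<^sup>2)"
  proof -
    \<comment> \<open>Equal laws give equal second moments, so expanding both squared distances
      leaves only the inner products.\<close>
    have "l2 M Y = l2 (distr M borel Y) (\<lambda>y. y)" by (simp add: l2_distr)
    also have "\<dots> = l2 M (\<lambda>w. ?T (X w))" unfolding law by (simp add: l2_distr)
    finally show ?thesis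
      by (simp add: l2_diff_power2[OF sX sY] l2_diff_power2[OF sX sTX] algebra_simps)
  qed
  finally show ?thesis .
qed

theorem corollary3p9:
  fixes L :: real
    and \<mu> \<nu> \<mu>\<^sub>h \<nu>\<^sub>h :: "(real ^ 'd) measure"
    and \<phi> :: "real ^ 'd \<Rightarrow> real"
    and T :: "real ^ 'd \<Rightarrow> real ^ 'd"
    and \<gamma> \<gamma>\<^sub>h :: "((real ^ 'd) \<times> (real ^ 'd)) measure"
    and e \<epsilon> e' :: real
  assumes "L > 0"
    and "\<mu> \<in> P2" and "\<nu> \<in> P2"
    and "lambda_regular L \<mu> \<nu> \<phi>"
    and "T = gradient \<phi>"
    and "\<gamma> = distr \<mu> borel (\<lambda>x. (x, T x))"
    and "\<mu>\<^sub>h \<in> P2" and "\<nu>\<^sub>h \<in> P2"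
    and "\<gamma>\<^sub>h \<in> transport_plans \<mu>\<^sub>h \<nu>\<^sub>h"
    and "e = W2 \<mu> \<mu>\<^sub>h + W2 \<nu> \<nu>\<^sub>h"
    and "\<epsilon> = sqrt (enn2real (transport_cost \<gamma>\<^sub>h)) - W2 \<mu>\<^sub>h \<nu>\<^sub>h"
    and "e' = e + \<epsilon> / 2"
  shows "W2 \<gamma> \<gamma>\<^sub>h \<le> 2 * sqrt L * sqrt e' * sqrt (W2 \<mu> \<nu> + e') + e"
proof -
  note plan = \<open>\<gamma>\<^sub>h \<in> transport_plans \<mu>\<^sub>h \<nu>\<^sub>h\<close>
  note \<gamma>h = transport_planD[OF plan]
  let ?W = "W2 \<mu> \<nu>"
  have reg: "convex_on UNIV \<phi>" "lambda_smooth L \<phi>" "distr \<mu> borel T = \<nu>"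
    and T [measurable]: "T \<in> borel_measurable borel"
    using assms(4,5) by (auto simp: lambda_regular_def optimal_transport_map_def)
  have tri: "W2 \<mu>\<^sub>h \<nu>\<^sub>h \<le> W2 \<mu>\<^sub>h \<mu> + (?W + W2 \<nu> \<nu>\<^sub>h)"
    using W2_triangle[of \<mu>\<^sub>h \<mu> \<nu>\<^sub>h] W2_triangle[of \<mu> \<nu> \<nu>\<^sub>h] assms(2,3,7,8) by force
  let ?C = "l2 \<gamma>\<^sub>h (\<lambda>z. fst z - snd z)"
  have C: "?C = \<epsilon> + W2 \<mu>\<^sub>h \<nu>\<^sub>h"
    using transport_cost_plan(3)[OF plan assms(7,8)] assms(11) by (simp add: l2_nonneg)
  have approx: "W2 \<gamma> \<gamma>\<^sub>h \<le> sqrt (L * ((?W + 2 * e' + 2 * \<delta>)\<^sup>2 - ?W\<^sup>2)) + (e + 2 * \<delta>)"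
    if \<delta>: "\<delta> > 0" for \<delta> :: real
  proof -
    \<comment> \<open>Starting from \<open>\<gamma>\<^sub>h\<close>, a point of law \<mu> is
      attached to the first coordinate, then one of law \<nu> to the second. Each attachment costs
      one \<delta>.\<close>
    obtain N where N: "prob_space N" "sets N = sets (\<gamma>\<^sub>h \<Otimes>\<^sub>M borel)"
      "distr N \<gamma>\<^sub>h fst = \<gamma>\<^sub>h" "distr N borel snd = \<mu>"
      "l2 N (\<lambda>z. fst (fst z) - snd z) \<le> W2 (distr \<gamma>\<^sub>h borel fst) \<mu> + \<delta>"
      by (rule attach_near_optimal[OF \<gamma>h(1,5) _ assms(2) \<delta>]) (simp_all add: \<gamma>h assms)
    have m: "fst \<in> measurable N \<gamma>\<^sub>h" "snd \<in> borel_measurable N"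
      by (simp_all add: measurable_cong_sets[OF N(2) refl])
    have m': "(\<lambda>z. snd (fst z)) \<in> borel_measurable N"
      by (rule measurable_compose[OF m(1) \<gamma>h(6)])
    have "distr N borel (\<lambda>z. snd (fst z)) = distr (distr N \<gamma>\<^sub>h fst) borel snd"
      by (subst distr_distr) (simp_all add: \<gamma>h m o_def)
    then have law': "distr N borel (\<lambda>z. snd (fst z)) = \<nu>\<^sub>h" using N(3) \<gamma>h(4) by simp
    obtain K where K: "prob_space K" "sets K = sets (N \<Otimes>\<^sub>M borel)"
      "distr K N fst = N" "distr K borel snd = \<nu>"
      "l2 K (\<lambda>z. snd (fst (fst z)) - snd z) \<le> W2 (distr N borel (\<lambda>z. snd (fst z))) \<nu> + \<delta>"
      by (rule attach_near_optimal[OF N(1) m' _ assms(3) \<delta>]) (simp_all add: law' assms)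
    have k: "fst \<in> measurable K N" "snd \<in> borel_measurable K"
      by (simp_all add: measurable_cong_sets[OF K(2) refl])
    \<comment> \<open>Names for the coordinates on \<open>K\<close>: \<open>X\<close> and
      \<open>Y\<close> are the two attached points, and \<open>Z\<close> is the original pair of law
      \<open>\<gamma>\<^sub>h\<close>.\<close>
    define X where "X z = snd (fst z)" for z :: "(((real ^ 'd) \<times> (real ^ 'd)) \<times> (real ^ 'd)) \<times> (real ^ 'd)"
    define Y where "Y z = snd z" for z :: "(((real ^ 'd) \<times> (real ^ 'd)) \<times> (real ^ 'd)) \<times> (real ^ 'd)"
    define Z where "Z z = fst (fst z)" for z :: "(((real ^ 'd) \<times> (real ^ 'd)) \<times> (real ^ 'd)) \<times> (real ^ 'd)"
    have X [measurable]: "X \<in> borel_measurable K"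
      unfolding X_def by (rule measurable_compose[OF k(1) m(2)])
    have Y [measurable]: "Y \<in> borel_measurable K"
      unfolding Y_def by (rule k(2))
    have Z: "Z \<in> measurable K \<gamma>\<^sub>h"
      unfolding Z_def by (rule measurable_compose[OF k(1) m(1)])
    then have Z' [measurable]: "Z \<in> borel_measurable K"
      by (simp add: measurable_cong_sets[OF refl \<gamma>h(2)])
    have "distr K borel X = distr (distr K N fst) borel snd"
      by (subst distr_distr) (simp_all add: k m o_def X_def[abs_def])
    then have law_X: "distr K borel X = \<mu>" by (simp add: K(3) N(4))
    have law_Y: "distr K borel Y = \<nu>" using K(4) by (simp add: Y_def[abs_def])
    have "distr K \<gamma>\<^sub>h Z = distr (distr K N fst) \<gamma>\<^sub>h fst"
      by (subst distr_distr) (simp_all add: k m o_def Z_def[abs_def])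
    then have law_Z: "distr K \<gamma>\<^sub>h Z = \<gamma>\<^sub>h" by (simp add: K(3) N(3))
    have sX: "square_integrable K X" and sY: "square_integrable K Y"
      by (rule square_integrable_law; simp add: law_X law_Y assms)+
    have sZ: "square_integrable K (\<lambda>z. fst (Z z))" "square_integrable K (\<lambda>z. snd (Z z))"
      using transport_cost_plan(1,2)[OF plan assms(7,8)] law_Z \<gamma>h(5,6)
        square_integrable_distr[OF Z, of fst] square_integrable_distr[OF Z, of snd] by simp_all
    have "distr K borel (\<lambda>z. T (X z)) = distr (distr K borel X) borel T"
      by (subst distr_distr) (simp_all add: o_def)
    also have "\<dots> = \<nu>" by (simp add: law_X reg(3))
    finally have law_TX: "distr K borel (\<lambda>z. T (X z)) = \<nu>" .
    have sTX: "square_integrable K (\<lambda>z. T (X z))"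
      by (rule square_integrable_law) (simp_all add: law_TX assms(3))
    have C_Z: "l2 K (\<lambda>z. fst (Z z) - snd (Z z)) = ?C"
      using l2_distr[OF Z, of "\<lambda>z. fst z - snd z"] law_Z \<gamma>h(5,6) by simp
    have "l2 K (\<lambda>z. fst (Z z) - X z) = l2 N (\<lambda>z. fst (fst z) - snd z)"
      using l2_distr[OF k(1), of "\<lambda>z. fst (fst z) - snd z"] K(3) m
        measurable_compose[OF m(1) \<gamma>h(5)] by (simp add: X_def Z_def)
    then have dX: "l2 K (\<lambda>z. X z - fst (Z z)) \<le> W2 \<mu> \<mu>\<^sub>h + \<delta>"
      using N(5) \<gamma>h(3) W2_commute[OF assms(2,7)] by (simp add: l2_minus_commute[of _ X])
    have dY: "l2 K (\<lambda>z. snd (Z z) - Y z) \<le> W2 \<nu> \<nu>\<^sub>h + \<delta>"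
      using K(5) law' W2_commute[OF assms(3,8)] by (simp add: Y_def Z_def)
    have "l2 K (\<lambda>z. X z - Y z) \<le> l2 K (\<lambda>z. X z - fst (Z z)) + l2 K (\<lambda>z. fst (Z z) - Y z)"
      by (intro l2_triangle_diff sX sY sZ)
    also have "l2 K (\<lambda>z. fst (Z z) - Y z) \<le> ?C + l2 K (\<lambda>z. snd (Z z) - Y z)"
      unfolding C_Z[symmetric] by (intro l2_triangle_diff sX sY sZ)
    \<comment> \<open>Here \<open>2 * e' = 2 * e + \<epsilon>\<close>: one \<open>e\<close> comes
      from moving \<open>X\<close> and \<open>Y\<close> to the coordinates of \<open>Z\<close>, the
      other from \<open>tri\<close>, which bounds the part of \<open>?C\<close> beyond
      \<epsilon>.\<close>
    finally have XY: "l2 K (\<lambda>z. X z - Y z) \<le> ?W + 2 * e' + 2 * \<delta>"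
      using dX dY C tri assms(10,12) W2_commute[OF assms(2,7)] by simp
    have W: "?W \<le> l2 K (\<lambda>z. X z - T (X z))"
      using W2_le_l2[OF K(1) sX sTX] by (simp add: law_X law_TX)
    have "(l2 K (\<lambda>z. T (X z) - Y z))\<^sup>2 \<le> L * ((l2 K (\<lambda>z. X z - Y z))\<^sup>2 - (l2 K (\<lambda>z. X z - T (X z)))\<^sup>2)"
      using transport_gap[OF K(1) sX sY _ assms(1) reg(1,2)] sTX T law_Y law_TX
      by (simp add: assms(5))
    also have "\<dots> \<le> L * ((?W + 2 * e' + 2 * \<delta>)\<^sup>2 - ?W\<^sup>2)"
      using assms(1) XY W W2_nonneg[of \<mu> \<nu>]
      by (intro mult_left_mono diff_mono power_mono) (auto simp: l2_nonneg)
    finally have TY: "l2 K (\<lambda>z. T (X z) - Y z) \<le> sqrt (L * ((?W + 2 * e' + 2 * \<delta>)\<^sup>2 - ?W\<^sup>2))"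
      by (rule real_le_rsqrt)
    have "\<gamma> = distr (distr K borel X) borel (\<lambda>x. (x, T x))"
      by (simp add: law_X assms(6))
    also have "\<dots> = distr K borel (\<lambda>z. (X z, T (X z)))"
      by (subst distr_distr) (simp_all add: o_def)
    finally have law_\<gamma>: "\<gamma> = distr K borel (\<lambda>z. (X z, T (X z)))" .
    have "distr K borel Z = distr K \<gamma>\<^sub>h Z" by (rule distr_cong) (simp_all add: \<gamma>h)
    then have law_Z': "distr K borel Z = \<gamma>\<^sub>h" using law_Z by simp
    have sZ': "square_integrable K Z"
      using square_integrable_Pair[OF sZ] by simp
    have sXT: "square_integrable K (\<lambda>z. (X z, T (X z)))"
      by (rule square_integrable_Pair[OF sX sTX])
    have sn: "square_integrable K (\<lambda>z. norm (X z - fst (Z z)))"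
        "square_integrable K (\<lambda>z. norm (T (X z) - snd (Z z)))"
      by (intro square_integrable_norm square_integrable_diff sX sTX sZ)+
    have "W2 \<gamma> \<gamma>\<^sub>h \<le> l2 K (\<lambda>z. (X z, T (X z)) - Z z)"
      using W2_le_l2[OF K(1) sXT sZ'] by (simp add: law_\<gamma> law_Z')
    \<comment> \<open>The product norm is at most the sum of the component norms, which lets the two
      components be estimated separately.\<close>
    also have "\<dots> \<le> l2 K (\<lambda>z. norm (X z - fst (Z z)) + norm (T (X z) - snd (Z z)))"
    proof (rule l2_mono)
      show "AE z in K. norm ((X z, T (X z)) - Z z)
          \<le> norm (norm (X z - fst (Z z)) + norm (T (X z) - snd (Z z)))"
        by (rule AE_I2) (simp add: norm_prod_def sqrt_sum_squares_le_sum)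
    qed (intro square_integrable_diff square_integrable_add sXT sZ' sn)+
    also have "\<dots> \<le> l2 K (\<lambda>z. norm (X z - fst (Z z))) + l2 K (\<lambda>z. norm (T (X z) - snd (Z z)))"
      by (rule l2_triangle[OF sn])
    also have "\<dots> = l2 K (\<lambda>z. X z - fst (Z z)) + l2 K (\<lambda>z. T (X z) - snd (Z z))"
      by (simp add: l2_def)
    \<comment> \<open>Passing through \<open>Y\<close> splits off the term bounded by
      \<open>TY\<close>; the rest combines with \<open>dX\<close> to
      \<open>e + 2 * \<delta>\<close>.\<close>
    also have "l2 K (\<lambda>z. T (X z) - snd (Z z)) \<le> l2 K (\<lambda>z. T (X z) - Y z) + l2 K (\<lambda>z. Y z - snd (Z z))"
      by (intro l2_triangle_diff sTX sY sZ)
    finally show ?thesis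
      using dX dY TY assms(10) by (simp add: l2_minus_commute[of _ Y])
  qed
  let ?f = "\<lambda>\<delta>. sqrt (L * ((?W + 2 * e' + 2 * \<delta>)\<^sup>2 - ?W\<^sup>2)) + (e + 2 * \<delta>)"
  have "(?f \<longlongrightarrow> ?f 0) (at_right 0)"
    by (intro tendsto_intros)
  moreover have "\<forall>\<^sub>F \<delta> in at_right 0. W2 \<gamma> \<gamma>\<^sub>h \<le> ?f \<delta>"
    unfolding eventually_at_right[OF zero_less_one] using approx by (intro exI[of _ 1]) auto
  ultimately have "W2 \<gamma> \<gamma>\<^sub>h \<le> ?f 0"
    by (intro tendsto_lowerbound[of ?f _ "at_right 0"]) auto
  \<comment> \<open>At \<delta> = 0 the difference of squares factors as
    \<open>4 * e' * (?W + e')\<close>, which explains the constant 2 in front.\<close>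
  also have "L * ((?W + 2 * e' + 2 * 0)\<^sup>2 - ?W\<^sup>2) = 2\<^sup>2 * (L * e' * (?W + e'))"
    by (simp add: power2_eq_square algebra_simps)
  also have "sqrt \<dots> = 2 * sqrt L * sqrt e' * sqrt (?W + e')"
    by (simp add: real_sqrt_mult)
  finally show ?thesis by simp
qed

end
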